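(* Let $Y$ be a finite set, $\mathbb{M}$ a complete MV-chain, $f:\mathbb{M}^Y\to\mathbb{M}^Y$ a non-expansive function and $H_{\min}$ a min-decomposition of $f$. Consider the following procedure: (1) choose any strategy $C_0$ in $H_{\min}$ and set $i:=0$; (2a) compute $\mu f_{C_i}$; (2b) if the set $\mathit{imp}_{\min}(C_i)$ of min-improvements of $C_i$ is nonempty, choose any $C_{i+1}\in\mathit{imp}_{\min}(C_i)$, set $i:=i+1$ and go to (2a); (2c) else, if $\mu f_{C_i}\neq\mu f$, choose any pre-fixpoint $a$ of $f$ with $a\sqsubset\mu f_{C_i}$, define the strategy $C_{i+1}$ by choosing, for each $y\in Y$, $C_{i+1}(y)\in H_{\min}(y)$ such that $C_{i+1}(y)(a)=\min_{h\in H_{\min}(y)}h(a)$, set $i:=i+1$ and go to (2a); (2d) else stop. Then every run of this procedure terminates, and when it stops, $\mu f_{C_i}=\mu f$.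
   Context: An MV-algebra is a tuple $(\mathbb{M},\oplus,0,\overline{(\cdot)})$ where $(\mathbb{M},\oplus,0)$ is a commutative monoid and $\overline{(\cdot)}:\mathbb{M}\to\mathbb{M}$ satisfies, for all $x,y$: $\overline{\overline{x}}=x$, $x\oplus\overline{0}=\overline{0}$, and $\overline{(\overline{x}\oplus y)}\oplus y=\overline{(\overline{y}\oplus x)}\oplus x$. Write $x\ominus y=\overline{\overline{x}\oplus y}$. The natural order is $x\sqsubseteq y$ iff $x\oplus z=y$ for some $z\in\mathbb{M}$. An MV-chain is an MV-algebra whose natural order is total; it is complete if it is a complete lattice under the natural order. For a set $Y$, $\mathbb{M}^Y$ carries the pointwise order and pointwise $\ominus$; $a\sqsubset b$ means $a\sqsubseteq b$ and $a\neq b$. For finite $Y$ and $a\in\mathbb{M}^Y$, $\|a\|=\max_{y\in Y}a(y)$. A function $g:\mathbb{M}^Y\to\mathbb{M}^Z$ is non-expansive if $\|g(b)\ominus g(a)\|\sqsubseteq\|b\ominus a\|$ for all $a,b\in\mathbb{M}^Y$. For a monotone endofunction $g$ on a complete lattice, $\mu g$ is its least fixpoint; a pre-fixpoint of $g$ is an $a$ with $g(a)\sqsubseteq a$. A min-decomposition of $f:\mathbb{M}^Y\to\mathbb{M}^Y$ is a map $H_{\min}$ assigning to each $y\in Y$ a finite set $H_{\min}(y)$ of monotone functions $\mathbb{M}^Y\to\mathbb{M}$ such that $f(a)(y)=\min_{h\in H_{\min}(y)}h(a)$ for all $a\in\mathbb{M}^Y$, $y\in Y$. A strategy in $H_{\min}$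 is a function $C$ on $Y$ with $C(y)\in H_{\min}(y)$ for all $y$; it induces the monotone map $f_C:\mathbb{M}^Y\to\mathbb{M}^Y$, $f_C(a)(y)=C(y)(a)$. Given strategies $C,C'$ in $H_{\min}$, $C'$ is a min-improvement of $C$ if $f_{C'}(\mu f_C)\sqsubset\mu f_C$; $\mathit{imp}_{\min}(C)$ denotes the set of min-improvements of $C$. *)

theory Defs
  imports Main "HOL-Library.FuncSet"
begin

class mv_algebra = comm_monoid_add +
  fixes mv_neg :: "'a \<Rightarrow> 'a"
  assumes mv_neg_neg: "mv_neg (mv_neg x) = x"
    and add_mv_neg_zero: "x + mv_neg 0 = mv_neg 0"
    and mv_lukasiewicz: "mv_neg (mv_neg x + y) + y = mv_neg (mv_neg y + x) + x"

definition mv_diff :: "'m::mv_algebra \<Rightarrow> 'm \<Rightarrow> 'm"  (infixl \<open>\<ominus>\<close> 65)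
  where "x \<ominus> y = mv_neg (mv_neg x + y)"

text \<open>In an MV-chain the order of the order classes is the natural order of the MV-algebra.\<close>

class mv_chain = mv_algebra + linorder +
  assumes le_iff_natural: "x \<le> y \<longleftrightarrow> (\<exists>z. x + z = y)"

class complete_mv_chain = mv_chain + complete_linorder

text \<open>
  The power of the algebra by a set \<open>Y\<close> (which may be empty) consists of the functions that are
  \<open>undefined\<close> outside \<open>Y\<close>.  On these, the order on the function type is the pointwise order on
  \<open>Y\<close>, because any two of them agree outside \<open>Y\<close>.
\<close>

abbreviation mv_pow :: "'y set \<Rightarrow> ('y \<Rightarrow> 'm) set"
  where "mv_pow Y \<equiv> Y \<rightarrow>\<^sub>E UNIV"

definition mv_diff_fun :: "'y set \<Rightarrow> ('y \<Rightarrow> 'm::mv_algebra) \<Rightarrow> ('y \<Rightarrow> 'm) \<Rightarrow> ('y \<Rightarrow> 'm)"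
  where "mv_diff_fun Y b a = (\<lambda>y\<in>Y. b y \<ominus> a y)"

text \<open>
  For empty \<open>Y\<close> the norm is an unspecified constant; for endofunctions, both sides of the
  inequality defining non-expansiveness are then this same constant.
\<close>

definition mv_norm :: "'y set \<Rightarrow> ('y \<Rightarrow> 'm::linorder) \<Rightarrow> 'm"
  where "mv_norm Y a = Max (a ` Y)"

definition nonexpansive ::
    "'y set \<Rightarrow> 'z set \<Rightarrow> (('y \<Rightarrow> 'm::mv_chain) \<Rightarrow> ('z \<Rightarrow> 'm)) \<Rightarrow> bool"
  where "nonexpansive Y Z g \<longleftrightarrow>
    (\<forall>a\<in>mv_pow Y. \<forall>b\<in>mv_pow Y.
      mv_norm Z (mv_diff_fun Z (g b) (g a)) \<le> mv_norm Y (mv_diff_fun Y b a))"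

definition mu :: "'y set \<Rightarrow> (('y \<Rightarrow> 'm::order) \<Rightarrow> ('y \<Rightarrow> 'm)) \<Rightarrow> ('y \<Rightarrow> 'm)"
  where "mu Y g = (LEAST a. a \<in> mv_pow Y \<and> g a = a)"

text \<open>The sets \<open>H y\<close> have to be nonempty for the minimum to exist.\<close>

definition min_decomposition ::
    "'y set \<Rightarrow> (('y \<Rightarrow> 'm::linorder) \<Rightarrow> ('y \<Rightarrow> 'm)) \<Rightarrow> ('y \<Rightarrow> (('y \<Rightarrow> 'm) \<Rightarrow> 'm) set) \<Rightarrow> bool"
  where "min_decomposition Y f H \<longleftrightarrow>
    (\<forall>y\<in>Y. finite (H y) \<and> H y \<noteq> {} \<and> (\<forall>h\<in>H y. mono_on (mv_pow Y) h)) \<and>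
    (\<forall>a\<in>mv_pow Y. \<forall>y\<in>Y. f a y = Min ((\<lambda>h. h a) ` H y))"

definition strategies ::
    "'y set \<Rightarrow> ('y \<Rightarrow> (('y \<Rightarrow> 'm) \<Rightarrow> 'm) set) \<Rightarrow> ('y \<Rightarrow> (('y \<Rightarrow> 'm) \<Rightarrow> 'm)) set"
  where "strategies Y H = Pi\<^sub>E Y H"

definition strategy_map ::
    "'y set \<Rightarrow> ('y \<Rightarrow> (('y \<Rightarrow> 'm) \<Rightarrow> 'm)) \<Rightarrow> ('y \<Rightarrow> 'm) \<Rightarrow> ('y \<Rightarrow> 'm)"
  where "strategy_map Y C a = (\<lambda>y\<in>Y. C y a)"

definition imp_min ::
    "'y set \<Rightarrow> ('y \<Rightarrow> (('y \<Rightarrow> 'm::order) \<Rightarrow> 'm) set) \<Rightarrow> ('y \<Rightarrow> (('y \<Rightarrow> 'm) \<Rightarrow> 'm))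
      \<Rightarrow> ('y \<Rightarrow> (('y \<Rightarrow> 'm) \<Rightarrow> 'm)) set"
  where "imp_min Y H C =
    {C' \<in> strategies Y H.
      strategy_map Y C' (mu Y (strategy_map Y C)) < mu Y (strategy_map Y C)}"

text \<open>There is no rule for stopping: the procedure stops at a strategy without successor.\<close>

inductive iteration_step ::
    "'y set \<Rightarrow> (('y \<Rightarrow> 'm::linorder) \<Rightarrow> ('y \<Rightarrow> 'm)) \<Rightarrow> ('y \<Rightarrow> (('y \<Rightarrow> 'm) \<Rightarrow> 'm) set)
      \<Rightarrow> ('y \<Rightarrow> (('y \<Rightarrow> 'm) \<Rightarrow> 'm)) \<Rightarrow> ('y \<Rightarrow> (('y \<Rightarrow> 'm) \<Rightarrow> 'm)) \<Rightarrow> bool"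
  for Y f H
  where
    improve: "C' \<in> imp_min Y H C \<Longrightarrow> iteration_step Y f H C C'"
  | jump: "\<lbrakk>imp_min Y H C = {}; mu Y (strategy_map Y C) \<noteq> mu Y f;
      a \<in> mv_pow Y; f a \<le> a; a < mu Y (strategy_map Y C);
      C' \<in> strategies Y H; \<forall>y\<in>Y. C' y a = Min ((\<lambda>h. h a) ` H y)\<rbrakk>
      \<Longrightarrow> iteration_step Y f H C C'"

end

theory Submission imports Defs begin

text \<open>
  Every step strictly decreases the least fixpoint of the current strategy's map: an improvement
  \<open>C'\<close> has \<open>\<mu> f\<^sub>C\<close> as a pre-fixpoint that is not a fixpoint, and a jump makes some \<open>a \<sqsubset> \<mu> f\<^sub>C\<close> a
  pre-fixpoint of the new map.  As there are only finitely many strategies, every run terminates.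
  Since \<open>f \<sqsubseteq> f\<^sub>C\<close>, always \<open>\<mu> f \<sqsubseteq> \<mu> f\<^sub>C\<close>; when they differ, \<open>\<mu> f\<close> itself is a pre-fixpoint that allows a jump.
\<close>

text \<open>Knaster-Tarski inside the carrier \<open>mv_pow Y\<close>: the pointwise infimum
  \<open>m\<close> of all pre-fixpoints is itself a pre-fixpoint, and by monotonicity so is
  \<open>g m\<close>, which forces \<open>m \<le> g m\<close>.\<close>

lemma mu_least_prefixpoint:
  fixes g :: "('y \<Rightarrow> 'm::complete_lattice) \<Rightarrow> ('y \<Rightarrow> 'm)"
  assumes "g \<in> mv_pow Y \<rightarrow> mv_pow Y" and "mono_on (mv_pow Y) g"
  shows mu_in_mv_pow: "mu Y g \<in> mv_pow Y"
    and mu_fixpoint: "g (mu Y g) = mu Y g"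
    and mu_lowerbound: "\<And>a. a \<in> mv_pow Y \<Longrightarrow> g a \<le> a \<Longrightarrow> mu Y g \<le> a"
proof -
  define P where "P = {a \<in> mv_pow Y. g a \<le> a}"
  \<comment> \<open>Restricting the infimum to \<open>Y\<close> keeps \<open>m\<close> in the
    carrier and makes it agree outside \<open>Y\<close> with every member of
    \<open>P\<close>.\<close>
  define m where "m = (\<lambda>y\<in>Y. INF a\<in>P. a y)"
  have m_pow: "m \<in> mv_pow Y"
    by (auto simp: m_def)
  have m_le: "m \<le> a" if "a \<in> P" for a
  proof (rule le_funI)
    fix y
    have "a \<in> mv_pow Y"
      using that by (simp add: P_def)
    then show "m y \<le> a y"
      using that by (cases "y \<in> Y") (auto simp: m_def dest: PiE_arb intro: INF_lower)
  qed
  have g_pow: "g m \<in> mv_pow Y"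
    using assms(1) m_pow by blast
  have "g m \<le> a" if "a \<in> P" for a
    using mono_onD[OF assms(2) m_pow _ m_le[OF that]] that by (auto simp: P_def)
  then have "g m y \<le> m y" for y
    using g_pow by (cases "y \<in> Y") (auto simp: m_def le_fun_def dest: PiE_arb intro: INF_greatest)
  then have pre: "g m \<le> m"
    by (rule le_funI)
  have "g m \<in> P"
    using mono_onD[OF assms(2) g_pow m_pow pre] g_pow by (simp add: P_def)
  with pre have fix_m: "g m = m"
    by (intro antisym m_le)
  have "mu Y g = m"
    unfolding mu_def by (rule Least_equality) (auto simp: m_pow fix_m P_def intro: m_le)
  then show "mu Y g \<in> mv_pow Y" "g (mu Y g) = mu Y g"
    "\<And>a. a \<in> mv_pow Y \<Longrightarrow> g a \<le> a \<Longrightarrow> mu Y g \<le> a"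
    using m_pow fix_m m_le by (auto simp: P_def)
qed

lemma strategy_map_in_mv_pow: "strategy_map Y C \<in> A \<rightarrow> mv_pow Y"
  by (auto simp: strategy_map_def)

lemma strategy_map_mono_on:
  fixes C :: "'y \<Rightarrow> ('y \<Rightarrow> 'm::linorder) \<Rightarrow> 'm"
  assumes "min_decomposition Y f H" and "C \<in> strategies Y H"
  shows "mono_on (mv_pow Y) (strategy_map Y C)"
proof (rule mono_onI, rule le_funI)
  fix a b :: "'y \<Rightarrow> 'm" and y
  assume "a \<in> mv_pow Y" "b \<in> mv_pow Y" "a \<le> b"
  moreover have "mono_on (mv_pow Y) (C y)" if "y \<in> Y"
    using assms that by (auto simp: min_decomposition_def strategies_def PiE_mem)
  ultimately show "strategy_map Y C a y \<le> strategy_map Y C b y"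
    by (auto simp: strategy_map_def dest: mono_onD)
qed

text \<open>At each point of \<open>Y\<close> a strategy picks one of the functions over which
  \<open>f\<close> takes the minimum; outside \<open>Y\<close> both sides are
  \<open>undefined\<close>.\<close>

lemma le_strategy_map:
  assumes "min_decomposition Y f H" and "f \<in> mv_pow Y \<rightarrow> mv_pow Y"
    and "C \<in> strategies Y H" and "a \<in> mv_pow Y"
  shows "f a \<le> strategy_map Y C a"
proof (rule le_funI)
  fix y
  have "f a \<in> mv_pow Y"
    using assms by blast
  then show "f a y \<le> strategy_map Y C a y"
    using assms by (cases "y \<in> Y")
      (auto simp: min_decomposition_def strategies_def strategy_map_def dest: PiE_arb PiE_mem intro!: Min_le)
qed

lemma strategy_map_eq_if_minimizing:
  assumes "min_decomposition Y f H" and "f \<in> mv_pow Y \<rightarrow> mv_pow Y" and "a \<in> mv_pow Y"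
    and "\<forall>y\<in>Y. C y a = Min ((\<lambda>h. h a) ` H y)"
  shows "strategy_map Y C a = f a"
proof
  fix y
  have "f a \<in> mv_pow Y"
    using assms by blast
  then show "strategy_map Y C a y = f a y"
    using assms by (cases "y \<in> Y") (auto simp: min_decomposition_def strategy_map_def dest: PiE_arb)
qed

text \<open>A minimum over a finite nonempty set is attained, so a minimizer can be chosen
  separately for each \<open>y\<close>. Such strategies serve both to prove \<open>f\<close>
  monotone and to supply the target of a jump.\<close>

lemma ex_minimizing_strategy:
  assumes "min_decomposition Y f H"
  obtains C where "C \<in> strategies Y H" and "\<forall>y\<in>Y. C y a = Min ((\<lambda>h. h a) ` H y)"
proof -
  have "\<forall>y\<in>Y. \<exists>h\<in>H y. h a = Min ((\<lambda>h. h a) ` H y)"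
  proof
    fix y assume "y \<in> Y"
    then have "Min ((\<lambda>h. h a) ` H y) \<in> (\<lambda>h. h a) ` H y"
      using assms by (intro Min_in) (auto simp: min_decomposition_def)
    then show "\<exists>h\<in>H y. h a = Min ((\<lambda>h. h a) ` H y)"
      by force
  qed
  then obtain C where "\<forall>y\<in>Y. C y \<in> H y \<and> C y a = Min ((\<lambda>h. h a) ` H y)"
    by metis
  then show thesis
    by (intro that[of "restrict C Y"]) (auto simp: strategies_def)
qed

lemma min_decomposition_mono_on:
  fixes f :: "('y \<Rightarrow> 'm::linorder) \<Rightarrow> ('y \<Rightarrow> 'm)"
  assumes "min_decomposition Y f H" and "f \<in> mv_pow Y \<rightarrow> mv_pow Y"
  shows "mono_on (mv_pow Y) f"
proof (rule mono_onI)
  fix a b :: "'y \<Rightarrow> 'm"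
  assume ab: "a \<in> mv_pow Y" "b \<in> mv_pow Y" "a \<le> b"
  \<comment> \<open>The strategy is minimizing at the larger argument \<open>b\<close>: it then
    equals \<open>f\<close> at \<open>b\<close>, while at \<open>a\<close> it only has to bound
    \<open>f\<close> from above.\<close>
  obtain C where C: "C \<in> strategies Y H" "\<forall>y\<in>Y. C y b = Min ((\<lambda>h. h b) ` H y)"
    using ex_minimizing_strategy[OF assms(1)] .
  have "f a \<le> strategy_map Y C a"
    using le_strategy_map assms C(1) ab(1) .
  also have "\<dots> \<le> strategy_map Y C b"
    using strategy_map_mono_on[OF assms(1) C(1)] ab by (rule mono_onD)
  also have "\<dots> = f b"
    using strategy_map_eq_if_minimizing assms ab(2) C(2) .
  finally show "f a \<le> f b" .
qed

lemma finite_strategies: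
  assumes "finite Y" and "min_decomposition Y f H"
  shows "finite (strategies Y H)"
  using assms by (auto simp: strategies_def min_decomposition_def intro: finite_PiE)

lemma iteration_step_strategies:
  assumes "iteration_step Y f H C C'"
  shows "C' \<in> strategies Y H"
  using assms by cases (auto simp: imp_min_def)

lemma iteration_step_mu_less:
  fixes f :: "('y \<Rightarrow> 'm::complete_linorder) \<Rightarrow> ('y \<Rightarrow> 'm)"
  assumes dec: "min_decomposition Y f H" and f_pow: "f \<in> mv_pow Y \<rightarrow> mv_pow Y"
    and C: "C \<in> strategies Y H" and step: "iteration_step Y f H C C'"
  shows "mu Y (strategy_map Y C') < mu Y (strategy_map Y C)"
proof -
  note mono = strategy_map_mono_on[OF dec]
  note C' = iteration_step_strategies[OF step]
  note lower = mu_lowerbound[OF strategy_map_in_mv_pow mono[OF C']]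
  from step show ?thesis
  proof cases
    case improve
    let ?m = "mu Y (strategy_map Y C)"
    have less: "strategy_map Y C' ?m < ?m"
      using improve by (simp add: imp_min_def)
    \<comment> \<open>Were the two least fixpoints equal, \<open>?m\<close> would be fixed by the
      map of \<open>C'\<close>, against \<open>less\<close>.\<close>
    moreover have "mu Y (strategy_map Y C') \<noteq> ?m"
      using less mu_fixpoint[OF strategy_map_in_mv_pow mono[OF C']] by auto
    ultimately show ?thesis
      using lower[OF mu_in_mv_pow[OF strategy_map_in_mv_pow mono[OF C]]] by (simp add: less_le)
  next
    case (jump a)
    \<comment> \<open>As \<open>C'\<close> is minimizing at \<open>a\<close>, its map agrees there
      with \<open>f\<close>, and \<open>a\<close> is a pre-fixpoint of \<open>f\<close>. Strictness
      then comes from \<open>a\<close> lying strictly below the old least fixpoint.\<close>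
    have "strategy_map Y C' a \<le> a"
      using strategy_map_eq_if_minimizing[OF dec f_pow] jump by simp
    then show ?thesis
      using lower[of a] jump by auto
  qed
qed

lemma no_iteration_step_mu_eq:
  fixes f :: "('y \<Rightarrow> 'm::complete_linorder) \<Rightarrow> ('y \<Rightarrow> 'm)"
  assumes dec: "min_decomposition Y f H" and f_pow: "f \<in> mv_pow Y \<rightarrow> mv_pow Y"
    and C: "C \<in> strategies Y H" and stop: "\<nexists>C'. iteration_step Y f H C C'"
  shows "imp_min Y H C = {}" and "mu Y (strategy_map Y C) = mu Y f"
proof -
  show no_imp: "imp_min Y H C = {}"
    using stop by (auto intro: improve)
  let ?m = "mu Y (strategy_map Y C)"
  note f_mono = min_decomposition_mono_on[OF dec f_pow]
  note mono = strategy_map_mono_on[OF dec C]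
  have m_pow: "?m \<in> mv_pow Y"
    using mu_in_mv_pow[OF strategy_map_in_mv_pow mono] .
  \<comment> \<open>Since \<open>?m\<close> is fixed by the map of \<open>C\<close>, this makes it a
    pre-fixpoint of \<open>f\<close>.\<close>
  have "f ?m \<le> strategy_map Y C ?m"
    using le_strategy_map dec f_pow C m_pow .
  then have "mu Y f \<le> ?m"
    using mu_lowerbound[OF f_pow f_mono m_pow] mu_fixpoint[OF strategy_map_in_mv_pow mono] by simp
  moreover obtain C' where "C' \<in> strategies Y H" "\<forall>y\<in>Y. C' y (mu Y f) = Min ((\<lambda>h. h (mu Y f)) ` H y)"
    using ex_minimizing_strategy[OF dec] .
  \<comment> \<open>If \<open>mu Y f\<close> differed from \<open>?m\<close>, it would lie strictly
    below it, and a jump with \<open>a = mu Y f\<close> would contradict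
    \<open>stop\<close>.\<close>
  ultimately show "?m = mu Y f"
    using stop jump[OF no_imp, of f "mu Y f" C'] mu_in_mv_pow[OF f_pow f_mono]
      mu_fixpoint[OF f_pow f_mono] by (auto simp: less_le)
qed

theorem mainTheorem1:
  fixes Y :: "'y set"
    and f :: "('y \<Rightarrow> 'm::complete_mv_chain) \<Rightarrow> ('y \<Rightarrow> 'm)"
    and H :: "'y \<Rightarrow> (('y \<Rightarrow> 'm) \<Rightarrow> 'm) set"
  assumes "finite Y"
    and "f \<in> mv_pow Y \<rightarrow> mv_pow Y"
    and "nonexpansive Y Y f"
    and "min_decomposition Y f H"
  shows "(\<nexists>C :: nat \<Rightarrow> ('y \<Rightarrow> (('y \<Rightarrow> 'm) \<Rightarrow> 'm)).
            C 0 \<in> strategies Y H \<and> (\<forall>i. iteration_step Y f H (C i) (C (Suc i)))) \<and>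
         (\<forall>(C :: nat \<Rightarrow> ('y \<Rightarrow> (('y \<Rightarrow> 'm) \<Rightarrow> 'm))) n.
            C 0 \<in> strategies Y H \<and> (\<forall>i<n. iteration_step Y f H (C i) (C (Suc i))) \<and>
            (\<nexists>C'. iteration_step Y f H (C n) C') \<longrightarrow>
            imp_min Y H (C n) = {} \<and> mu Y (strategy_map Y (C n)) = mu Y f)"
proof (intro conjI allI impI notI)
  note dec = assms(4) and f_pow = assms(2)
  assume "\<exists>C :: nat \<Rightarrow> ('y \<Rightarrow> (('y \<Rightarrow> 'm) \<Rightarrow> 'm)).
    C 0 \<in> strategies Y H \<and> (\<forall>i. iteration_step Y f H (C i) (C (Suc i)))"
  then obtain C where C0: "C 0 \<in> strategies Y H"
    and step: "\<And>i. iteration_step Y f H (C i) (C (Suc i))"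
    by blast
  have C: "C i \<in> strategies Y H" for i
    using C0 iteration_step_strategies[OF step] by (cases i) auto
  define m where "m i = mu Y (strategy_map Y (C i))" for i
  have decr: "m (Suc i) < m i" for i
    unfolding m_def by (rule iteration_step_mu_less[OF dec f_pow C step])
  have anti: "m j < m i" if "i < j" for i j
    using that by (induction i j rule: less_Suc_induct) (auto intro: decr)
  \<comment> \<open>The order on functions is only partial, but the indices are linearly ordered, so
    any two distinct ones are covered by \<open>anti\<close>.\<close>
  have "inj m"
    by (rule linorder_injI) (use anti in force)
  \<comment> \<open>\<open>m i\<close> depends on \<open>i\<close> only through \<open>C i\<close>,
    so a repeated strategy would repeat a value of \<open>m\<close>.\<close>
  then have "inj C"
    by (auto simp: m_def inj_def)
  moreover have "finite (range C)"
    by (rule finite_subset[OF _ finite_strategies[OF assms(1) dec]]) (use C in auto)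
  ultimately show False
    using finite_imageD by blast
next
  fix C :: "nat \<Rightarrow> ('y \<Rightarrow> (('y \<Rightarrow> 'm) \<Rightarrow> 'm))" and n
  assume run: "C 0 \<in> strategies Y H \<and> (\<forall>i<n. iteration_step Y f H (C i) (C (Suc i))) \<and>
    (\<nexists>C'. iteration_step Y f H (C n) C')"
  \<comment> \<open>For \<open>n = 0\<close> this is the initial strategy, otherwise the target of
    the last step.\<close>
  then have "C n \<in> strategies Y H"
    by (cases n) (auto dest: iteration_step_strategies)
  then show "imp_min Y H (C n) = {}" "mu Y (strategy_map Y (C n)) = mu Y f"
    using no_iteration_step_mu_eq[OF assms(4) assms(2)] run by auto
qed

end
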